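(* Consider the Geometric Gradient Method with Momentum (GGMM, described in the context) with $a\ge1$ and $\tau>0$, with stopping condition based on P-stationarity. Assume that $f$ is continuously differentiable with $\nabla f$ locally Lipschitz continuous. Assume moreover that one of the following holds: (a) the max-rule is used to set $\mu_k$, and $f$ is bounded from below and uniformly continuous on the sublevel set $\mathcal L_0=\{x\in D\mid f(x)\le f(x_0)\}$; (b) the average-rule is used to set $\mu_k$. If $x_k$ is not a P-stationary point for every $k$, then any accumulation point $\bar x$ of the sequence $\{x_k\}$ generated by GGMM is a P-stationary point of the problem $\min_{x\in D}f(x)$. Moreover, for any converging subsequence $\{x_k\}_{k\in K}$ ($K\subset\mathbb N$ infinite), $$\lim_{k\in K,\,k\to\infty} d_{\widehat{\mathcal N}_D^P(x_{k+1})}(-\nabla f(x_{k+1}))=0.$$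
   Context: Let $\mathbb X$ be a Euclidean space (finite-dimensional real inner product space), $f:\mathbb X\to\mathbb R$ differentiable, $D\subset\mathbb X$ nonempty and closed (not necessarily convex). The problem is $\min f(x)$ subject to $x\in D$. The set-valued projection is $P_D(x)=\operatorname{argmin}_{z\in D}\|z-x\|$ (nonempty and compact for every $x$). For a nonempty set $S$, $d_S(x)$ denotes the distance $\inf_{z\in S}\|z-x\|$. Stationarity. For $x\in D$, the proximal normal cone $\widehat{\mathcal N}_D^P(x)$ is the set of all $v\in\mathbb X$ for which there exists $\bar\alpha>0$ with $x\in P_D(x+\bar\alpha v)$. A point $x\in D$ is P-stationary if $-\nabla f(x)\in\widehat{\mathcal N}_D^P(x)$. GGMM. Inputs: $x_0\in D$, $0\le\tau<\alpha_{\min}\le\alpha_{\max}<\infty$, $\beta_{\max}\ge0$, $c\in(0,1)$, $\delta\in(0,1)$, $a\ge1$. Set $x_{-1}=x_0$. For $k=0,1,2,\dots$, as long as $x_k$ does not satisfy the stopping condition (being a stationary point of the chosen type): choose any $\alpha_{k0}\in[\alpha_{\min},\alpha_{\max}]$ and $\beta_{k0}\in[0,\beta_{\max}]$; set a reference value $\mu_k\ge f(x_k)$; for $j=0,1,2,\dots$ let $\alpha_{kj}=\delta^j\alpha_{k0}$, $\beta_{kj}=\beta_{k0}$ if $j=0$ and $\beta_{kj}=\beta_{k0}\left(\frac{\max\{\alpha_{kj}-\tau,0\}}{\alpha_{k0}-\tau}\right)^a$ if $j\ge1$, and choose any $y_{kj}\in P_D(x_k-\alpha_{kj}\nabla f(x_k)+\beta_{kj}(x_k-x_{k-1}))$;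 the inner loop (backtracking) stops at the first $j$ such that $f(y_{kj})\le\mu_k-\frac{c}{2\alpha_{kj}}\|y_{kj}-x_k\|^2$. With this $j$, set $\alpha_k=\alpha_{kj}$, $\beta_k=\beta_{kj}$, $x_{k+1}=y_{kj}$. Rules for $\mu_k$. Max-rule, for some fixed $M\in\mathbb N$: $\mu_k=\max_{i\in\{\max\{0,k-M\},\dots,k\}}f(x_i)$. Average-rule, for some fixed $p\in(0,1]$: $\mu_k=(1-p)\mu_{k-1}+p f(x_k)$, with initial value $\mu_{-1}\ge f(x_0)$ (e.g. $\mu_{-1}=f(x_0)$). *)

theory Defs
  imports "HOL-Analysis.Analysis"
begin

definition proj_set :: "'a::euclidean_space set \<Rightarrow> 'a \<Rightarrow> 'a set" where
  "proj_set D x = {z. is_arg_min (\<lambda>z. norm (z - x)) (\<lambda>z. z \<in> D) z}"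

definition prox_normal_cone :: "'a::euclidean_space set \<Rightarrow> 'a \<Rightarrow> 'a set" where
  "prox_normal_cone D x = {v. \<exists>\<alpha>>0. x \<in> proj_set D (x + \<alpha> *\<^sub>R v)}"

text \<open>In everything below, \<open>g\<close> stands for the gradient of the objective \<open>f\<close>.\<close>

definition P_stationary :: "'a::euclidean_space set \<Rightarrow> ('a \<Rightarrow> 'a) \<Rightarrow> 'a \<Rightarrow> bool" where
  "P_stationary D g x \<longleftrightarrow> x \<in> D \<and> - g x \<in> prox_normal_cone D x"

definition trial_alpha :: "real \<Rightarrow> real \<Rightarrow> nat \<Rightarrow> real" where
  "trial_alpha \<delta> \<alpha>0 j = \<delta> ^ j * \<alpha>0"

definition trial_beta :: "real \<Rightarrow> real \<Rightarrow> real \<Rightarrow> real \<Rightarrow> real \<Rightarrow> nat \<Rightarrow> real" where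
  "trial_beta \<tau> \<delta> a \<alpha>0 \<beta>0 j =
     (if j = 0 then \<beta>0
      else \<beta>0 * (max (trial_alpha \<delta> \<alpha>0 j - \<tau>) 0 / (\<alpha>0 - \<tau>)) powr a)"

definition sufficient_decrease ::
  "('a::euclidean_space \<Rightarrow> real) \<Rightarrow> real \<Rightarrow> real \<Rightarrow> real \<Rightarrow> 'a \<Rightarrow> 'a \<Rightarrow> bool" where
  "sufficient_decrease f c \<mu> \<alpha> x y \<longleftrightarrow> f y \<le> \<mu> - c / (2 * \<alpha>) * (norm (y - x))\<^sup>2"

text \<open>One outer iteration with reference value \<open>\<mu>\<close>, leading from the iterates \<open>xprev\<close>, \<open>xcur\<close>
  to \<open>xnext\<close>. All free choices of the method are existentially quantified, so this is a relation;
  \<open>J\<close> is the index at which the backtracking loop stops.\<close>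

definition GGMM_iteration ::
  "'a::euclidean_space set \<Rightarrow> ('a \<Rightarrow> real) \<Rightarrow> ('a \<Rightarrow> 'a) \<Rightarrow>
   real \<Rightarrow> real \<Rightarrow> real \<Rightarrow> real \<Rightarrow> real \<Rightarrow> real \<Rightarrow> real \<Rightarrow>
   real \<Rightarrow> 'a \<Rightarrow> 'a \<Rightarrow> 'a \<Rightarrow> bool" where
  "GGMM_iteration D f g \<tau> \<alpha>min \<alpha>max \<beta>max c \<delta> a \<mu> xprev xcur xnext \<longleftrightarrow>
     f xcur \<le> \<mu> \<and>
     (\<exists>\<alpha>0\<in>{\<alpha>min..\<alpha>max}. \<exists>\<beta>0\<in>{0..\<beta>max}. \<exists>(y :: nat \<Rightarrow> 'a) J.
        (\<forall>j\<le>J. y j \<in> proj_set D (xcur - trial_alpha \<delta> \<alpha>0 j *\<^sub>R g xcur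
                                     + trial_beta \<tau> \<delta> a \<alpha>0 \<beta>0 j *\<^sub>R (xcur - xprev))) \<and>
        (\<forall>j<J. \<not> sufficient_decrease f c \<mu> (trial_alpha \<delta> \<alpha>0 j) xcur (y j)) \<and>
        sufficient_decrease f c \<mu> (trial_alpha \<delta> \<alpha>0 J) xcur (y J) \<and>
        xnext = y J)"

text \<open>Truncated subtraction on the naturals makes \<open>x (k - 1)\<close> equal to \<open>x 0\<close> for \<open>k = 0\<close>, which is
  the convention $x_{-1} = x_0$. Iterations are performed only until \<open>stop\<close> first holds; the
  values of \<open>x\<close> after that point are unconstrained.\<close>

definition GGMM_sequence ::
  "'a::euclidean_space set \<Rightarrow> ('a \<Rightarrow> real) \<Rightarrow> ('a \<Rightarrow> 'a) \<Rightarrow>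
   real \<Rightarrow> real \<Rightarrow> real \<Rightarrow> real \<Rightarrow> real \<Rightarrow> real \<Rightarrow> real \<Rightarrow>
   ('a \<Rightarrow> bool) \<Rightarrow> (nat \<Rightarrow> real) \<Rightarrow> (nat \<Rightarrow> 'a) \<Rightarrow> bool" where
  "GGMM_sequence D f g \<tau> \<alpha>min \<alpha>max \<beta>max c \<delta> a stop \<mu> x \<longleftrightarrow>
     x 0 \<in> D \<and>
     (\<forall>k. (\<forall>i\<le>k. \<not> stop (x i)) \<longrightarrow>
        GGMM_iteration D f g \<tau> \<alpha>min \<alpha>max \<beta>max c \<delta> a (\<mu> k) (x (k - 1)) (x k) (x (Suc k)))"

text \<open>Here truncated subtraction renders $\max\{0, k-M\}$.\<close>

definition max_rule ::
  "('a \<Rightarrow> real) \<Rightarrow> nat \<Rightarrow> (nat \<Rightarrow> 'a) \<Rightarrow> (nat \<Rightarrow> real) \<Rightarrow> bool" where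
  "max_rule f M x \<mu> \<longleftrightarrow> (\<forall>k. \<mu> k = Max ((\<lambda>i. f (x i)) ` {k - M..k}))"

text \<open>\<open>\<mu>init\<close> is the initial value $\mu_{-1}$.\<close>

definition average_rule ::
  "('a \<Rightarrow> real) \<Rightarrow> real \<Rightarrow> real \<Rightarrow> (nat \<Rightarrow> 'a) \<Rightarrow> (nat \<Rightarrow> real) \<Rightarrow> bool" where
  "average_rule f p \<mu>init x \<mu> \<longleftrightarrow>
     \<mu>init \<ge> f (x 0) \<and>
     (\<forall>k. \<mu> k = (1 - p) * (if k = 0 then \<mu>init else \<mu> (k - 1)) + p * f (x k))"

end

theory Submission
  imports Defs
begin

text \<open>
  Two facts make the method work. First, the acceptance test forces the steps
  \<open>x (Suc k) - x k\<close> to vanish. Under the max-rule this is the argument of Grippo, Lampariello and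
  Lucidi: the reference values decrease to a limit, and the acceptance test together with uniform
  continuity propagates this limit from the indices where the maximum is attained backwards
  through the whole window (\<open>max_rule_steps_vanish\<close>). Under the average-rule each step decreases
  the reference value by a multiple of its squared length, and the values of \<open>f\<close> along a
  convergent subsequence bound the reference values from below
  (\<open>steps_vanish_of_convergent_decrease\<close>).

  Second, the accepted step sizes stay away from zero near an accumulation point. Once the trial
  step size is at most \<open>\<tau>\<close> the momentum term is switched off, so the trial point is a
  plain projected gradient step, and local Lipschitz continuity of the gradient makes such a step
  acceptable when it is short (\<open>short_gradient_step_accepted\<close>, \<open>GGMM_iteration_accepted\<close>).

  Now let \<open>w\<close> be the point projected in iteration \<open>k\<close> and \<open>\<alpha>\<close> the accepted step size. The vector
  \<open>v = (w - x (Suc k)) / \<alpha>\<close> is a proximal normal at \<open>x (Suc k)\<close>, and it differs from \<open>- g (x k)\<close>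
  by a step and a momentum term divided by \<open>\<alpha>\<close>. Along a convergent subsequence this difference
  tends to zero, which gives the statement on distances. Since the radii \<open>\<alpha>\<close> of these proximal
  normals have a common positive lower bound, the inequalities that express proximality pass to the
  limit, which gives stationarity of the accumulation point.
\<close>

section \<open>Projections and proximal normals\<close>

text \<open>The variational form, obtained by expanding the square of
  \<open>y - w = (y - z) - (w - z)\<close>; unlike the norm inequality it is linear in \<open>w\<close>, so that a
  proximal normal can be rescaled.\<close>

lemma proj_set_iff_inner:
  "z \<in> proj_set D w \<longleftrightarrow> z \<in> D \<and> (\<forall>y\<in>D. 2 * ((w - z) \<bullet> (y - z)) \<le> (norm (y - z))\<^sup>2)"
proof -
  have "norm (z - w) \<le> norm (y - w) \<longleftrightarrow> 2 * ((w - z) \<bullet> (y - z)) \<le> (norm (y - z))\<^sup>2" for y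
  proof -
    have "(norm (y - w))\<^sup>2 = (norm (y - z))\<^sup>2 - 2 * ((w - z) \<bullet> (y - z)) + (norm (z - w))\<^sup>2"
      by (simp add: power2_norm_eq_inner inner_diff_left inner_diff_right inner_commute)
    moreover have "norm (z - w) \<le> norm (y - w) \<longleftrightarrow> (norm (z - w))\<^sup>2 \<le> (norm (y - w))\<^sup>2"
      by simp
    ultimately show ?thesis by linarith
  qed
  then show ?thesis
    unfolding proj_set_def is_arg_min_linorder by auto
qed

lemma prox_normal_cone_iff:
  "v \<in> prox_normal_cone D x \<longleftrightarrow>
     x \<in> D \<and> (\<exists>\<alpha>>0. \<forall>y\<in>D. 2 * \<alpha> * (v \<bullet> (y - x)) \<le> (norm (y - x))\<^sup>2)"
  unfolding prox_normal_cone_def proj_set_iff_inner by (auto simp: mult.assoc)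

section \<open>Acceptance of short steps\<close>

text \<open>The constant \<open>L\<close> instead of \<open>L / 2\<close> comes from using the mean value theorem at a single
  intermediate point; any constant serves to bound the step size.\<close>

lemma descent_on_ball:
  fixes f :: "'a::euclidean_space \<Rightarrow> real"
  assumes grad: "\<And>z. GDERIV f z :> g z"
    and lip: "L-lipschitz_on (ball z0 u) g"
    and x: "x \<in> ball z0 u" and y: "y \<in> ball z0 u"
  shows "f y \<le> f x + g x \<bullet> (y - x) + L * (norm (y - x))\<^sup>2"
proof -
  define \<phi> where "\<phi> t = x + t *\<^sub>R (y - x)" for t :: real
  have "((\<lambda>t. f (\<phi> t)) has_derivative (\<lambda>h. (h *\<^sub>R (y - x)) \<bullet> g (\<phi> t))) (at t within {0..1})" for t
  proof -
    have "(\<phi> has_derivative (\<lambda>h. h *\<^sub>R (y - x))) (at t within {0..1})"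
      unfolding \<phi>_def by (auto intro!: derivative_eq_intros)
    moreover have "(f has_derivative (\<lambda>h. h \<bullet> g (\<phi> t))) (at (\<phi> t))"
      using grad by (simp add: gderiv_def)
    ultimately show ?thesis
      by (rule has_derivative_compose)
  qed
  then obtain t where t: "t \<in> {0<..<1}" and "f (\<phi> 1) - f (\<phi> 0) = ((1 - 0) *\<^sub>R (y - x)) \<bullet> g (\<phi> t)"
    using mvt_simple[of 0 1 "\<lambda>t. f (\<phi> t)" "\<lambda>t h. (h *\<^sub>R (y - x)) \<bullet> g (\<phi> t)"] by auto
  then have eq: "f y - f x = g x \<bullet> (y - x) + (g (\<phi> t) - g x) \<bullet> (y - x)"
    by (simp add: \<phi>_def inner_diff_left inner_diff_right inner_commute)
  have "\<phi> t = (1 - t) *\<^sub>R x + t *\<^sub>R y"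
    by (simp add: \<phi>_def algebra_simps)
  then have "\<phi> t \<in> ball z0 u"
    using convexD_alt[OF convex_ball x y, of t] t by simp
  then have "norm (g (\<phi> t) - g x) \<le> L * norm (\<phi> t - x)"
    using lipschitz_onD[OF lip _ x] by (simp add: dist_norm)
  also have "\<dots> \<le> L * norm (y - x)"
    using t lipschitz_on_nonneg[OF lip]
    by (intro mult_left_mono) (auto simp: \<phi>_def mult_left_le_one_le)
  finally have "(g (\<phi> t) - g x) \<bullet> (y - x) \<le> (L * norm (y - x)) * norm (y - x)"
    by (meson norm_cauchy_schwarz norm_ge_zero mult_right_mono order_trans)
  then show ?thesis
    using eq by (simp add: power2_eq_square mult.assoc)
qed

text \<open>The projection inequality, tested at \<open>x\<close>, bounds the slope \<open>g x \<bullet> (y - x)\<close> by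
  \<open>- (norm (y - x))\<^sup>2 / (2 * \<alpha>)\<close>. For small \<open>\<alpha>\<close> this outweighs the quadratic error of the
  linear model by the factor that the acceptance test requires. Uniformity in \<open>x\<close> is the point:
  a single threshold \<open>A\<close> serves a whole neighbourhood of \<open>z0\<close>.\<close>

lemma short_gradient_step_accepted:
  fixes f :: "'a::euclidean_space \<Rightarrow> real"
  assumes grad: "\<And>z. GDERIV f z :> g z"
    and lip: "L-lipschitz_on (ball z0 u) g" and u: "0 < u" and c: "c < 1"
  obtains \<rho> A where "0 < \<rho>" "0 < A"
    "\<And>x \<alpha> y. \<lbrakk>x \<in> D; x \<in> ball z0 \<rho>; 0 < \<alpha>; \<alpha> \<le> A; y \<in> proj_set D (x - \<alpha> *\<^sub>R g x)\<rbrakk>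
       \<Longrightarrow> sufficient_decrease f c (f x) \<alpha> x y"
proof -
  have L: "0 \<le> L" by (rule lipschitz_on_nonneg[OF lip])
  define G where "G = norm (g z0) + L * u"
  have G: "0 \<le> G" using L u by (simp add: G_def)
  define A where "A = min (u / (4 * (G + 1))) ((1 - c) / (2 * (L + 1)))"
  have A: "0 < A" using G L u c by (simp add: A_def)
  have "sufficient_decrease f c (f x) \<alpha> x y"
    if xD: "x \<in> D" and x: "x \<in> ball z0 (u / 2)" and \<alpha>: "0 < \<alpha>" "\<alpha> \<le> A"
      and y: "y \<in> proj_set D (x - \<alpha> *\<^sub>R g x)" for x \<alpha> y
  proof -
    have xu: "x \<in> ball z0 u" using x u by simp
    have "norm (g x - g z0) \<le> L * norm (x - z0)"
      using lipschitz_onD[OF lip xu, of z0] u by (simp add: dist_norm)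
    also have "\<dots> \<le> L * u"
      using xu L by (intro mult_left_mono) (auto simp: dist_norm norm_minus_commute)
    finally have gx: "norm (g x) \<le> G"
      using norm_triangle_sub[of "g x" "g z0"] by (simp add: G_def)
    have "2 * ((x - \<alpha> *\<^sub>R g x - y) \<bullet> (x - y)) \<le> (norm (x - y))\<^sup>2"
      using y xD by (simp add: proj_set_iff_inner)
    then have slope: "(norm (y - x))\<^sup>2 \<le> - 2 * \<alpha> * (g x \<bullet> (y - x))"
      by (simp add: power2_norm_eq_inner inner_diff_left inner_diff_right inner_commute algebra_simps)
    also have "\<dots> = 2 * \<alpha> * ((- g x) \<bullet> (y - x))" by simp
    also have "\<dots> \<le> 2 * \<alpha> * (norm (g x) * norm (y - x))"
      using norm_cauchy_schwarz[of "- g x" "y - x"] \<alpha>(1) by (intro mult_left_mono) auto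
    finally have "norm (y - x) * norm (y - x) \<le> (2 * \<alpha> * norm (g x)) * norm (y - x)"
      by (simp add: power2_eq_square mult.assoc)
    then have "norm (y - x) \<le> 2 * \<alpha> * norm (g x)"
      using \<alpha> by (cases "norm (y - x) = 0") (auto simp: mult_le_cancel_right)
    also have "\<dots> \<le> 2 * A * G"
      using \<alpha> gx G by (intro mult_mono) auto
    also have "\<dots> \<le> 2 * (u / (4 * (G + 1))) * G"
      using G by (intro mult_right_mono) (auto simp: A_def)
    also have "\<dots> < u / 2"
      using G u by (simp add: field_simps)
    finally have "norm (y - x) < u / 2" .
    then have "y \<in> ball z0 u"
      using x dist_triangle[of z0 y x] by (simp add: dist_norm norm_minus_commute)
    then have desc: "f y \<le> f x + g x \<bullet> (y - x) + L * (norm (y - x))\<^sup>2"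
      using descent_on_ball[OF grad lip xu] by blast
    have "2 * L * \<alpha> \<le> 2 * (L + 1) * A"
      using \<alpha> A L by (intro mult_mono) auto
    also have "\<dots> \<le> 2 * (L + 1) * ((1 - c) / (2 * (L + 1)))"
      using L by (intro mult_left_mono) (auto simp: A_def)
    also have "\<dots> = 1 - c"
      using L by simp
    finally have "2 * L * \<alpha> * (norm (y - x))\<^sup>2 \<le> (1 - c) * (norm (y - x))\<^sup>2"
      by (intro mult_right_mono) auto
    with slope have "2 * \<alpha> * (g x \<bullet> (y - x) + L * (norm (y - x))\<^sup>2) \<le> - c * (norm (y - x))\<^sup>2"
      by (simp add: algebra_simps)
    then have "g x \<bullet> (y - x) + L * (norm (y - x))\<^sup>2 \<le> - (c / (2 * \<alpha>)) * (norm (y - x))\<^sup>2"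
      using \<alpha> by (simp add: field_simps)
    with desc show ?thesis
      by (simp add: sufficient_decrease_def)
  qed
  then show thesis
    using u A by (intro that[of "u / 2" A]) auto
qed

text \<open>The last conclusion bounds the accepted step size from below: if backtracking stops after
  the initial trial, the preceding trial was rejected. Had its step size been at most \<open>A \<le> \<tau>\<close>,
  its momentum coefficient would have been zero, and the hypothesis on plain gradient steps would
  contradict the rejection.\<close>

lemma GGMM_iteration_accepted:
  fixes f :: "'a::euclidean_space \<Rightarrow> real"
  assumes params: "0 < \<tau>" "\<tau> < \<alpha>min" "0 < \<delta>" "\<delta> < 1" "1 \<le> a"
    and iter: "GGMM_iteration D f g \<tau> \<alpha>min \<alpha>max \<beta>max c \<delta> a \<mu> xp xc xn"
  obtains \<alpha> \<beta> where "0 < \<alpha>" "\<alpha> \<le> \<alpha>max" "0 \<le> \<beta>" "\<beta> \<le> \<beta>max"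
    "xn \<in> proj_set D (xc - \<alpha> *\<^sub>R g xc + \<beta> *\<^sub>R (xc - xp))"
    "sufficient_decrease f c \<mu> \<alpha> xc xn"
    "\<And>A. \<lbrakk>0 < A; A \<le> \<tau>; \<And>\<alpha> y. \<lbrakk>0 < \<alpha>; \<alpha> \<le> A; y \<in> proj_set D (xc - \<alpha> *\<^sub>R g xc)\<rbrakk>
         \<Longrightarrow> sufficient_decrease f c (f xc) \<alpha> xc y\<rbrakk> \<Longrightarrow> \<delta> * A \<le> \<alpha>"
proof -
  from iter obtain \<alpha>0 \<beta>0 y J where mu: "f xc \<le> \<mu>"
    and range: "\<alpha>0 \<in> {\<alpha>min..\<alpha>max}" "\<beta>0 \<in> {0..\<beta>max}"
    and y: "\<forall>j\<le>J. y j \<in> proj_set D (xc - trial_alpha \<delta> \<alpha>0 j *\<^sub>R g xc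
                                     + trial_beta \<tau> \<delta> a \<alpha>0 \<beta>0 j *\<^sub>R (xc - xp))"
    and rejected: "\<forall>j<J. \<not> sufficient_decrease f c \<mu> (trial_alpha \<delta> \<alpha>0 j) xc (y j)"
    and acc: "sufficient_decrease f c \<mu> (trial_alpha \<delta> \<alpha>0 J) xc (y J)" and xn: "xn = y J"
    unfolding GGMM_iteration_def by blast
  have \<alpha>0: "\<alpha>min \<le> \<alpha>0" "\<alpha>0 \<le> \<alpha>max" and \<beta>0: "0 \<le> \<beta>0" "\<beta>0 \<le> \<beta>max"
    using range by auto
  have pos: "0 < trial_alpha \<delta> \<alpha>0 j" for j
    using params \<alpha>0 by (simp add: trial_alpha_def)
  have le0: "trial_alpha \<delta> \<alpha>0 j \<le> \<alpha>0" for j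
    using params \<alpha>0 by (simp add: trial_alpha_def mult_left_le_one_le power_le_one)
  have beta: "0 \<le> trial_beta \<tau> \<delta> a \<alpha>0 \<beta>0 J" "trial_beta \<tau> \<delta> a \<alpha>0 \<beta>0 J \<le> \<beta>0"
  proof -
    have "max (trial_alpha \<delta> \<alpha>0 J - \<tau>) 0 / (\<alpha>0 - \<tau>) \<le> 1"
      using le0[of J] params \<alpha>0 by (simp add: divide_le_eq_1)
    moreover have "0 \<le> max (trial_alpha \<delta> \<alpha>0 J - \<tau>) 0 / (\<alpha>0 - \<tau>)"
      using params \<alpha>0 by simp
    ultimately have "(max (trial_alpha \<delta> \<alpha>0 J - \<tau>) 0 / (\<alpha>0 - \<tau>)) powr a \<le> 1"
      using params by (intro powr_le1) linarith+
    then show "0 \<le> trial_beta \<tau> \<delta> a \<alpha>0 \<beta>0 J" "trial_beta \<tau> \<delta> a \<alpha>0 \<beta>0 J \<le> \<beta>0"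
      using \<beta>0 by (auto simp: trial_beta_def intro!: mult_left_le)
  qed
  have "\<delta> * A \<le> trial_alpha \<delta> \<alpha>0 J"
    if A: "0 < A" "A \<le> \<tau>"
      and short: "\<And>\<alpha> y. \<lbrakk>0 < \<alpha>; \<alpha> \<le> A; y \<in> proj_set D (xc - \<alpha> *\<^sub>R g xc)\<rbrakk>
         \<Longrightarrow> sufficient_decrease f c (f xc) \<alpha> xc y" for A
  proof (cases J)
    case 0
    have "\<delta> * A \<le> 1 * A"
      using params A by (intro mult_right_mono) auto
    then show ?thesis
      using params(2) A(2) \<alpha>0(1) unfolding 0 trial_alpha_def power_0 by linarith
  next
    case (Suc j)
    have "A < trial_alpha \<delta> \<alpha>0 j"
    proof (rule ccontr)
      assume "\<not> A < trial_alpha \<delta> \<alpha>0 j"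
      then have small: "trial_alpha \<delta> \<alpha>0 j \<le> A" by simp
      then have "j \<noteq> 0"
        using A \<alpha>0 params by (cases j) (auto simp: trial_alpha_def)
      then have "trial_beta \<tau> \<delta> a \<alpha>0 \<beta>0 j = 0"
        using small A by (simp add: trial_beta_def)
      then have "sufficient_decrease f c (f xc) (trial_alpha \<delta> \<alpha>0 j) xc (y j)"
        using y[rule_format, of j] Suc by (intro short[OF pos small]) simp
      then have "sufficient_decrease f c \<mu> (trial_alpha \<delta> \<alpha>0 j) xc (y j)"
        using mu by (simp add: sufficient_decrease_def)
      then show False
        using rejected Suc by simp
    qed
    moreover have "trial_alpha \<delta> \<alpha>0 J = \<delta> * trial_alpha \<delta> \<alpha>0 j"
      using Suc by (simp add: trial_alpha_def)
    ultimately show ?thesis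
      using params by simp
  qed
  then show thesis
    by (rule that[OF pos order.trans[OF le0 \<alpha>0(2)] beta(1) order.trans[OF beta(2) \<beta>0(2)]
          y[rule_format, OF order_refl, folded xn] acc[folded xn]])
qed

section \<open>Vanishing steps\<close>

lemma tendsto_zero_of_square_bound:
  fixes s e :: "nat \<Rightarrow> real"
  assumes "0 < \<sigma>" "\<forall>\<^sub>F n in sequentially. \<sigma> * (s n)\<^sup>2 \<le> e n" "e \<longlonglongrightarrow> 0"
  shows "s \<longlonglongrightarrow> 0"
proof -
  have lim: "(\<lambda>n. e n / \<sigma>) \<longlonglongrightarrow> 0"
    using tendsto_divide[OF assms(3) tendsto_const, of \<sigma>] assms(1) by simp
  have le: "\<forall>\<^sub>F n in sequentially. (s n)\<^sup>2 \<le> e n / \<sigma>"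
    using assms(2) by eventually_elim (use assms(1) in \<open>simp add: field_simps\<close>)
  have "(\<lambda>n. (s n)\<^sup>2) \<longlonglongrightarrow> 0"
    by (rule tendsto_sandwich[OF _ le tendsto_const lim]) simp
  then show ?thesis by simp
qed

lemma steps_vanish_of_convergent_decrease:
  fixes \<mu> s :: "nat \<Rightarrow> real"
  assumes "0 < \<sigma>" and dec: "\<And>k. \<mu> (Suc k) \<le> \<mu> k - \<sigma> * (s k)\<^sup>2" and lb: "\<And>k. B \<le> \<mu> k"
  shows "s \<longlonglongrightarrow> 0"
proof -
  have "0 \<le> \<sigma> * (s k)\<^sup>2" for k
    using assms(1) by simp
  then have "\<mu> (Suc k) \<le> \<mu> k" for k
    using dec[of k] by (smt (verit))
  then have "decseq \<mu>" by (rule decseq_SucI)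
  then obtain l where l: "\<mu> \<longlonglongrightarrow> l"
    by (rule decseq_convergent[OF _ allI[OF lb]])
  then have "(\<lambda>k. \<mu> k - \<mu> (Suc k)) \<longlonglongrightarrow> l - l"
    by (intro tendsto_diff LIMSEQ_Suc)
  moreover have "\<sigma> * (s k)\<^sup>2 \<le> \<mu> k - \<mu> (Suc k)" for k
    using dec[of k] by linarith
  ultimately show ?thesis
    by (intro tendsto_zero_of_square_bound[OF assms(1), of s "\<lambda>k. \<mu> k - \<mu> (Suc k)"]) auto
qed

lemma decseq_window_Max:
  fixes F :: "nat \<Rightarrow> real"
  assumes "\<And>k. F (Suc k) \<le> Max (F ` {k - M..k})"
  shows "decseq (\<lambda>k. Max (F ` {k - M..k}))"
proof (rule decseq_SucI)
  fix k
  have "F i \<le> Max (F ` {k - M..k})" if "i \<in> {Suc k - M..Suc k}" for i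
  proof (cases "i = Suc k")
    case False
    then have "i \<in> {k - M..k}" using that by auto
    then show ?thesis by (intro Max_ge) auto
  qed (use assms in simp)
  then show "Max (F ` {Suc k - M..Suc k}) \<le> Max (F ` {k - M..k})"
    by (intro Max.boundedI) auto
qed

text \<open>The maxima \<open>m\<close> decrease to a limit \<open>l\<close>. If \<open>p k\<close> is an index in the window at which the maximum
  is attained, then \<open>f (x (p k))\<close> tends to \<open>l\<close> as well. Whenever \<open>f (x (p k - j))\<close> tends to \<open>l\<close>,
  the decrease condition squeezes the step that leads to \<open>x (p k - j)\<close> to zero, and uniform
  continuity then carries the limit to \<open>f (x (p k - Suc j))\<close>. Every step index lies within a
  bounded distance before some \<open>p k\<close>, so all steps vanish.\<close>

lemma max_rule_steps_vanish:
  fixes f :: "'a::metric_space \<Rightarrow> real" and x :: "nat \<Rightarrow> 'a"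
  assumes S: "\<And>k. x k \<in> S" and uc: "uniformly_continuous_on S f" and bdd: "bdd_below (f ` S)"
    and \<sigma>: "0 < \<sigma>"
    and dec: "\<And>k. f (x (Suc k))
      \<le> Max ((\<lambda>i. f (x i)) ` {k - M..k}) - \<sigma> * (dist (x (Suc k)) (x k))\<^sup>2"
  shows "(\<lambda>k. dist (x (Suc k)) (x k)) \<longlonglongrightarrow> 0"
proof -
  define m where "m k = Max ((\<lambda>i. f (x i)) ` {k - M..k})" for k
  define s where "s k = dist (x (Suc k)) (x k)" for k
  have dec': "f (x (Suc k)) \<le> m k - \<sigma> * (s k)\<^sup>2" for k
    using dec by (simp add: m_def s_def)
  have "0 \<le> \<sigma> * (s k)\<^sup>2" for k using \<sigma> by simp
  then have "f (x (Suc k)) \<le> m k" for k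
    using dec'[of k] by (smt (verit))
  then have "decseq m"
    using decseq_window_Max[of "\<lambda>i. f (x i)" M] by (simp add: m_def[abs_def])
  moreover obtain B where B: "B \<le> f (x k)" for k
    using bdd S by (auto simp: bdd_below_def)
  have "f (x k) \<le> m k" for k
    unfolding m_def by (intro Max_ge) auto
  then have "B \<le> m k" for k
    using B order.trans by blast
  then have "\<forall>k. B \<le> m k" by blast
  ultimately obtain l where l: "m \<longlonglongrightarrow> l"
    by (rule decseq_convergent)
  have "\<exists>i\<in>{k - M..k}. f (x i) = m k" for k
  proof -
    have "m k \<in> (\<lambda>i. f (x i)) ` {k - M..k}"
      unfolding m_def by (intro Max_in) auto
    then show ?thesis by force
  qed
  then obtain p where p: "\<And>k. k - M \<le> p k" "\<And>k. p k \<le> k" "\<And>k. f (x (p k)) = m k"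
    by (metis atLeastAtMost_iff)
  have step: "(\<lambda>k. s (p k - Suc j)) \<longlonglongrightarrow> 0" if "(\<lambda>k. f (x (p k - j))) \<longlonglongrightarrow> l" for j
  proof -
    have "filterlim (\<lambda>k. p k - Suc j) at_top sequentially"
      unfolding filterlim_at_top
    proof
      fix Z
      show "\<forall>\<^sub>F k in sequentially. Z \<le> p k - Suc j"
        using eventually_ge_at_top[of "Z + M + Suc j"]
      proof eventually_elim
        case (elim k)
        then show ?case using p(1)[of k] by linarith
      qed
    qed
    then have "(\<lambda>k. m (p k - Suc j)) \<longlonglongrightarrow> l"
      by (rule filterlim_compose[OF l])
    then have "(\<lambda>k. m (p k - Suc j) - f (x (p k - j))) \<longlonglongrightarrow> l - l"
      using that by (rule tendsto_diff)
    moreover have "\<forall>\<^sub>F k in sequentially.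
        \<sigma> * (s (p k - Suc j))\<^sup>2 \<le> m (p k - Suc j) - f (x (p k - j))"
      using eventually_ge_at_top[of "M + Suc j"]
    proof eventually_elim
      case (elim k)
      then have "Suc (p k - Suc j) = p k - j"
        using p(1)[of k] by linarith
      then show ?case
        using dec'[of "p k - Suc j"] by simp
    qed
    ultimately show ?thesis
      using tendsto_zero_of_square_bound[OF \<sigma>] by simp
  qed
  have lim: "(\<lambda>k. f (x (p k - j))) \<longlonglongrightarrow> l" for j
  proof (induction j)
    case 0
    then show ?case using l by (simp add: p(3))
  next
    case (Suc j)
    \<comment> \<open>If \<open>p k \<le> j\<close>, truncated subtraction makes the two points equal.\<close>
    have "dist (x (p k - j)) (x (p k - Suc j)) \<le> s (p k - Suc j)" for k
      by (cases "p k \<le> j") (auto simp: s_def Suc_diff_Suc)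
    then have "(\<lambda>k. dist (x (p k - j)) (x (p k - Suc j))) \<longlonglongrightarrow> 0"
      by (intro tendsto_sandwich[OF _ _ tendsto_const step[OF Suc.IH]] always_eventually) auto
    then have "(\<lambda>k. dist (f (x (p k - j))) (f (x (p k - Suc j)))) \<longlonglongrightarrow> 0"
      using S by (intro uc[unfolded uniformly_continuous_on_sequentially, rule_format]) simp
    then have "(\<lambda>k. f (x (p k - j)) - f (x (p k - Suc j))) \<longlonglongrightarrow> 0"
      by (simp add: dist_real_def tendsto_rabs_zero_iff)
    then show ?case
      using tendsto_diff[OF Suc.IH] by fastforce
  qed
  have le: "s k \<le> (\<Sum>j\<le>M. s (p (k + (M + 1)) - Suc j))" for k
  proof -
    define j where "j = p (k + (M + 1)) - Suc k"
    have "j \<le> M" and k: "k = p (k + (M + 1)) - Suc j"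
      using p(1,2)[of "k + (M + 1)"] by (auto simp: j_def)
    have "s (p (k + (M + 1)) - Suc j) \<le> (\<Sum>j\<le>M. s (p (k + (M + 1)) - Suc j))"
      using \<open>j \<le> M\<close> by (intro member_le_sum) (auto simp: s_def)
    then show ?thesis using k by simp
  qed
  have lim_sum: "(\<lambda>k. \<Sum>j\<le>M. s (p (k + (M + 1)) - Suc j)) \<longlonglongrightarrow> 0"
    by (intro tendsto_null_sum LIMSEQ_ignore_initial_segment[OF step[OF lim]])
  have "s \<longlonglongrightarrow> 0"
    by (rule tendsto_sandwich[OF _ _ tendsto_const lim_sum])
      (use le in \<open>auto simp only: s_def zero_le_dist eventually_sequentially\<close>)
  then show ?thesis by (simp add: s_def[abs_def])
qed

section \<open>Accumulation points\<close>

text \<open>The radius of the proximal normals \<open>v i\<close> must not degenerate: with the common bound \<open>A\<close> the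
  proximal inequality for a fixed test point is closed under limits.\<close>

lemma prox_normal_limit:
  fixes v :: "nat \<Rightarrow> 'a::euclidean_space"
  assumes D: "closed D" and A: "0 < A"
    and zD: "\<And>i. z i \<in> D"
    and prox: "\<forall>\<^sub>F i in sequentially. \<forall>y\<in>D. 2 * A * (v i \<bullet> (y - z i)) \<le> (norm (y - z i))\<^sup>2"
    and lim: "v \<longlonglongrightarrow> w" "z \<longlonglongrightarrow> zbar"
  shows "w \<in> prox_normal_cone D zbar"
  unfolding prox_normal_cone_iff
proof (intro conjI exI[of _ A] ballI)
  show "zbar \<in> D"
    by (rule closed_sequentially[OF D zD lim(2)])
  fix y assume "y \<in> D"
  show "2 * A * (w \<bullet> (y - zbar)) \<le> (norm (y - zbar))\<^sup>2"
  proof (rule tendsto_le[OF sequentially_bot])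
    show "(\<lambda>i. 2 * A * (v i \<bullet> (y - z i))) \<longlonglongrightarrow> 2 * A * (w \<bullet> (y - zbar))"
      by (intro tendsto_intros lim)
    show "(\<lambda>i. (norm (y - z i))\<^sup>2) \<longlonglongrightarrow> (norm (y - zbar))\<^sup>2"
      by (intro tendsto_intros lim)
    show "\<forall>\<^sub>F i in sequentially. 2 * A * (v i \<bullet> (y - z i)) \<le> (norm (y - z i))\<^sup>2"
      using prox by eventually_elim (use \<open>y \<in> D\<close> in blast)
  qed
qed (rule A)

theorem theorem4p12:
  fixes D :: "'a::euclidean_space set"
    and f :: "'a \<Rightarrow> real"
    and g :: "'a \<Rightarrow> 'a"
    and \<tau> \<alpha>min \<alpha>max \<beta>max c \<delta> a :: real
    and \<mu> :: "nat \<Rightarrow> real"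
    and x :: "nat \<Rightarrow> 'a"
  assumes D: "D \<noteq> {}" "closed D"
    and grad: "\<forall>z. GDERIV f z :> g z"
    and C1: "continuous_on UNIV g"
    and loc_lip: "\<forall>z. \<exists>u>0. \<exists>L. L-lipschitz_on (ball z u) g"
    and params: "0 < \<tau>" "\<tau> < \<alpha>min" "\<alpha>min \<le> \<alpha>max" "0 \<le> \<beta>max"
      "0 < c" "c < 1" "0 < \<delta>" "\<delta> < 1" "1 \<le> a"
    and run: "GGMM_sequence D f g \<tau> \<alpha>min \<alpha>max \<beta>max c \<delta> a (P_stationary D g) \<mu> x"
    and rule:
      "((\<exists>M. max_rule f M x \<mu>) \<and>
          bdd_below (f ` {z \<in> D. f z \<le> f (x 0)}) \<and>
          uniformly_continuous_on {z \<in> D. f z \<le> f (x 0)} f) \<or>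
       (\<exists>p \<mu>init. 0 < p \<and> p \<le> 1 \<and> average_rule f p \<mu>init x \<mu>)"
    and not_stationary: "\<forall>k. \<not> P_stationary D g (x k)"
  shows "(\<forall>xbar r. strict_mono r \<longrightarrow> (x \<circ> r) \<longlonglongrightarrow> xbar \<longrightarrow> P_stationary D g xbar) \<and>
         (\<forall>r. strict_mono r \<longrightarrow> convergent (x \<circ> r) \<longrightarrow>
            (\<lambda>i. infdist (- g (x (Suc (r i)))) (prox_normal_cone D (x (Suc (r i))))) \<longlonglongrightarrow> 0)"
proof -
  have iter: "GGMM_iteration D f g \<tau> \<alpha>min \<alpha>max \<beta>max c \<delta> a (\<mu> k) (x (k - 1)) (x k) (x (Suc k))" for k
    using run not_stationary unfolding GGMM_sequence_def by blast
  \<comment> \<open>Fixing one accepted step size and momentum coefficient per iteration turns the relational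
    description of the run into sequences whose limits can be taken.\<close>
  define accepted_with where "accepted_with k \<alpha> \<beta> \<longleftrightarrow>
      0 < \<alpha> \<and> \<alpha> \<le> \<alpha>max \<and> 0 \<le> \<beta> \<and> \<beta> \<le> \<beta>max \<and>
      x (Suc k) \<in> proj_set D (x k - \<alpha> *\<^sub>R g (x k) + \<beta> *\<^sub>R (x k - x (k - 1))) \<and>
      sufficient_decrease f c (\<mu> k) \<alpha> (x k) (x (Suc k)) \<and>
      (\<forall>A. 0 < A \<and> A \<le> \<tau> \<and> (\<forall>\<alpha> y. 0 < \<alpha> \<and> \<alpha> \<le> A \<and> y \<in> proj_set D (x k - \<alpha> *\<^sub>R g (x k))
         \<longrightarrow> sufficient_decrease f c (f (x k)) \<alpha> (x k) y) \<longrightarrow> \<delta> * A \<le> \<alpha>)" for k \<alpha> \<beta>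
  have "\<exists>\<alpha> \<beta>. accepted_with k \<alpha> \<beta>" for k
  proof (rule GGMM_iteration_accepted[OF params(1,2,7,8,9) iter[of k]])
    fix \<alpha> \<beta>
    assume h: "0 < \<alpha>" "\<alpha> \<le> \<alpha>max" "0 \<le> \<beta>" "\<beta> \<le> \<beta>max"
      "x (Suc k) \<in> proj_set D (x k - \<alpha> *\<^sub>R g (x k) + \<beta> *\<^sub>R (x k - x (k - 1)))"
      "sufficient_decrease f c (\<mu> k) \<alpha> (x k) (x (Suc k))"
    assume lower: "\<And>A. \<lbrakk>0 < A; A \<le> \<tau>;
         \<And>\<alpha> y. \<lbrakk>0 < \<alpha>; \<alpha> \<le> A; y \<in> proj_set D (x k - \<alpha> *\<^sub>R g (x k))\<rbrakk>
           \<Longrightarrow> sufficient_decrease f c (f (x k)) \<alpha> (x k) y\<rbrakk> \<Longrightarrow> \<delta> * A \<le> \<alpha>"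
    have "accepted_with k \<alpha> \<beta>"
      unfolding accepted_with_def
      by (intro conjI h allI impI, elim conjE, rule lower) auto
    then show ?thesis by blast
  qed
  then obtain \<alpha> \<beta> where chosen: "\<And>k. accepted_with k (\<alpha> k) (\<beta> k)"
    by metis
  have \<alpha>: "0 < \<alpha> k" "\<alpha> k \<le> \<alpha>max" and \<beta>: "0 \<le> \<beta> k" "\<beta> k \<le> \<beta>max"
    and proj: "x (Suc k) \<in> proj_set D (x k - \<alpha> k *\<^sub>R g (x k) + \<beta> k *\<^sub>R (x k - x (k - 1)))"
    and accepted: "sufficient_decrease f c (\<mu> k) (\<alpha> k) (x k) (x (Suc k))" for k
    using chosen[of k] unfolding accepted_with_def by blast+
  have step_size: "\<delta> * A \<le> \<alpha> k"
    if "0 < A" "A \<le> \<tau>"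
      "\<And>\<alpha> y. \<lbrakk>0 < \<alpha>; \<alpha> \<le> A; y \<in> proj_set D (x k - \<alpha> *\<^sub>R g (x k))\<rbrakk>
         \<Longrightarrow> sufficient_decrease f c (f (x k)) \<alpha> (x k) y" for A k
    using chosen[of k] that unfolding accepted_with_def by blast
  have xD: "x k \<in> D" for k
    using run proj by (cases k) (auto simp: GGMM_sequence_def proj_set_iff_inner)
  define \<sigma> where "\<sigma> = c / (2 * \<alpha>max)"
  have \<sigma>: "0 < \<sigma>" using params by (simp add: \<sigma>_def)
  have dec: "f (x (Suc k)) \<le> \<mu> k - \<sigma> * (dist (x (Suc k)) (x k))\<^sup>2" for k
  proof -
    have "\<sigma> \<le> c / (2 * \<alpha> k)"
      using \<alpha>[of k] params by (simp add: \<sigma>_def frac_le)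
    then have "\<sigma> * (dist (x (Suc k)) (x k))\<^sup>2 \<le> c / (2 * \<alpha> k) * (norm (x (Suc k) - x k))\<^sup>2"
      unfolding dist_norm by (rule mult_right_mono) simp
    then show ?thesis
      using accepted[of k] by (simp add: sufficient_decrease_def)
  qed

  have steps: "(\<lambda>k. dist (x (Suc k)) (x k)) \<longlonglongrightarrow> 0"
    if r: "strict_mono r" "(x \<circ> r) \<longlonglongrightarrow> xbar" for r xbar
    using rule
  proof (elim disjE conjE exE)
    fix M
    assume max: "max_rule f M x \<mu>" and bdd: "bdd_below (f ` {z \<in> D. f z \<le> f (x 0)})"
      and uc: "uniformly_continuous_on {z \<in> D. f z \<le> f (x 0)} f"
    have \<mu>: "\<mu> k = Max ((\<lambda>i. f (x i)) ` {k - M..k})" for k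
      using max by (simp add: max_rule_def)
    have "f (x (Suc k)) \<le> \<mu> k" for k
      using dec[of k] \<sigma> by (smt (verit) mult_nonneg_nonneg zero_le_power2)
    then have "decseq \<mu>"
      using decseq_window_Max[of "\<lambda>i. f (x i)" M] by (simp add: \<mu>[abs_def])
    then have "\<mu> k \<le> \<mu> 0" for k
      by (simp add: decseq_def)
    moreover have "f (x k) \<le> \<mu> k" for k
      using iter by (simp add: GGMM_iteration_def)
    moreover have "\<mu> 0 = f (x 0)" by (simp add: \<mu>)
    ultimately have "x k \<in> {z \<in> D. f z \<le> f (x 0)}" for k
      using xD by (auto intro: order.trans)
    then show ?thesis
      using max_rule_steps_vanish[OF _ uc bdd \<sigma>, of x M] dec by (simp add: \<mu>)
  next
    fix p \<mu>init
    assume p: "0 < p" "p \<le> 1" and avg: "average_rule f p \<mu>init x \<mu>"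
    have mu_dec: "\<mu> (Suc k) \<le> \<mu> k - (p * \<sigma>) * (dist (x (Suc k)) (x k))\<^sup>2" for k
    proof -
      have "\<mu> (Suc k) = (1 - p) * \<mu> k + p * f (x (Suc k))"
        using avg by (simp add: average_rule_def)
      also have "\<dots> \<le> (1 - p) * \<mu> k + p * (\<mu> k - \<sigma> * (dist (x (Suc k)) (x k))\<^sup>2)"
        using dec[of k] p by (simp add: mult_left_mono)
      finally show ?thesis by (simp add: algebra_simps)
    qed
    \<comment> \<open>The lower bound on \<open>\<mu>\<close> comes from the subsequence: being decreasing, \<open>\<mu>\<close> is at
      least its values at later indices, hence at least \<open>f\<close> at members of the subsequence.\<close>
    have p\<sigma>: "0 < p * \<sigma>" using p \<sigma> by simp
    have "\<mu> (Suc k) \<le> \<mu> k" for k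
      using mu_dec[of k] p\<sigma> by (smt (verit) mult_nonneg_nonneg zero_le_power2)
    then have "decseq \<mu>" by (rule decseq_SucI)
    have "isCont f xbar"
      using grad by (metis gderiv_def has_derivative_continuous)
    then have "(\<lambda>i. f ((x \<circ> r) i)) \<longlonglongrightarrow> f xbar"
      using r(2) by (rule isCont_tendsto_compose)
    then have "bdd_below (range (\<lambda>i. f (x (r i))))"
      by (auto dest!: convergentI convergent_imp_Bseq Bseq_bdd_below)
    then obtain B where B: "\<And>i. B \<le> f (x (r i))"
      by (auto simp: bdd_below_def)
    have "B \<le> \<mu> k" for k
    proof -
      have "B \<le> \<mu> (r k)"
        using B[of k] iter[of "r k"] by (simp add: GGMM_iteration_def)
      also have "\<dots> \<le> \<mu> k"
        using \<open>decseq \<mu>\<close> seq_suble[OF r(1), of k] by (simp add: decseq_def)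
      finally show ?thesis .
    qed
    then show ?thesis
      using steps_vanish_of_convergent_decrease[of "p * \<sigma>" \<mu> "\<lambda>k. dist (x (Suc k)) (x k)" B]
        p\<sigma> mu_dec by blast
  qed

  \<comment> \<open>The proximal normal at the new iterate that the projection step produces.\<close>
  define v where "v k = (1 / \<alpha> k) *\<^sub>R
    (x k - \<alpha> k *\<^sub>R g (x k) + \<beta> k *\<^sub>R (x k - x (k - 1)) - x (Suc k))" for k
  have prox: "2 * \<alpha> k * (v k \<bullet> (y - x (Suc k))) \<le> (norm (y - x (Suc k)))\<^sup>2" if "y \<in> D" for k y
    using proj[of k] that \<alpha>(1)[of k] unfolding proj_set_iff_inner v_def by auto
  have v_cone: "v k \<in> prox_normal_cone D (x (Suc k))" for k
    unfolding prox_normal_cone_iff using prox xD \<alpha> by blast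

  have key: "(\<lambda>i. v (r i)) \<longlonglongrightarrow> - g xbar \<and> (\<lambda>i. x (Suc (r i))) \<longlonglongrightarrow> xbar \<and>
      - g xbar \<in> prox_normal_cone D xbar"
    if r: "strict_mono r" "(x \<circ> r) \<longlonglongrightarrow> xbar" for r xbar
  proof -
    have r_top: "filterlim r at_top sequentially"
      using r(1) by (rule filterlim_subseq)
    have xr: "(\<lambda>i. x (r i)) \<longlonglongrightarrow> xbar"
      using r(2) by (simp add: o_def)
    have s1: "(\<lambda>i. dist (x (Suc (r i))) (x (r i))) \<longlonglongrightarrow> 0"
      by (rule filterlim_compose[OF steps[OF r] r_top])
    have "(\<lambda>k. dist (x k) (x (k - 1))) \<longlonglongrightarrow> 0"
      by (rule LIMSEQ_imp_Suc) (use steps[OF r] in simp)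
    then have s2: "(\<lambda>i. dist (x (r i)) (x (r i - 1))) \<longlonglongrightarrow> 0"
      by (rule filterlim_compose[OF _ r_top])
    have next_lim: "(\<lambda>i. x (Suc (r i))) \<longlonglongrightarrow> xbar"
    proof -
      have "(\<lambda>i. x (Suc (r i)) - x (r i)) \<longlonglongrightarrow> 0"
        using s1 by (simp add: dist_norm tendsto_norm_zero_iff)
      from tendsto_add[OF this xr] show ?thesis by simp
    qed

    obtain u L where u: "0 < u" and lip: "L-lipschitz_on (ball xbar u) g"
      using loc_lip by blast
    obtain \<rho> A0 where \<rho>: "0 < \<rho>" and A0: "0 < A0"
      and short: "\<And>z \<alpha> y. \<lbrakk>z \<in> D; z \<in> ball xbar \<rho>; 0 < \<alpha>; \<alpha> \<le> A0; y \<in> proj_set D (z - \<alpha> *\<^sub>R g z)\<rbrakk>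
         \<Longrightarrow> sufficient_decrease f c (f z) \<alpha> z y"
      using short_gradient_step_accepted[OF _ lip u params(6), of f D] grad by blast
    \<comment> \<open>The minimum with \<open>\<tau>\<close> ensures that trials this short carry no momentum; the factor \<open>\<delta>\<close>
      accounts for one backtracking step beyond the last rejected trial.\<close>
    define A where "A = \<delta> * min A0 \<tau>"
    have A: "0 < A" using A0 params by (simp add: A_def)
    have "\<forall>\<^sub>F i in sequentially. x (r i) \<in> ball xbar \<rho>"
      using topological_tendstoD[OF xr open_ball, of xbar \<rho>] \<rho> by simp
    then have A_le: "\<forall>\<^sub>F i in sequentially. A \<le> \<alpha> (r i)"
    proof eventually_elim
      case (elim i)
      show ?case
        unfolding A_def by (rule step_size) (use A0 params short[OF xD elim] in auto)
    qed

    have v_eq: "v k + g (x k) = (1 / \<alpha> k) *\<^sub>R (\<beta> k *\<^sub>R (x k - x (k - 1)) - (x (Suc k) - x k))" for k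
      using \<alpha>(1)[of k] by (simp add: v_def algebra_simps)
    have "(\<lambda>i. v (r i) + g (x (r i))) \<longlonglongrightarrow> 0"
    proof (rule Lim_null_comparison)
      show "\<forall>\<^sub>F i in sequentially. norm (v (r i) + g (x (r i)))
          \<le> (1 / A) * (\<beta>max * dist (x (r i)) (x (r i - 1)) + dist (x (Suc (r i))) (x (r i)))"
        using A_le
      proof eventually_elim
        case (elim i)
        define d where "d = \<beta> (r i) *\<^sub>R (x (r i) - x (r i - 1)) - (x (Suc (r i)) - x (r i))"
        have "norm d \<le> \<beta> (r i) * norm (x (r i) - x (r i - 1)) + norm (x (Suc (r i)) - x (r i))"
          unfolding d_def using norm_triangle_ineq4 \<beta>(1)[of "r i"]
          by (metis abs_of_nonneg norm_scaleR)
        also have "\<dots> \<le> \<beta>max * dist (x (r i)) (x (r i - 1)) + dist (x (Suc (r i))) (x (r i))"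
          using \<beta>(2)[of "r i"] by (simp add: dist_norm mult_right_mono)
        finally have d: "norm d \<le> \<dots>" .
        have "norm (v (r i) + g (x (r i))) = (1 / \<alpha> (r i)) * norm d"
          using v_eq[of "r i"] \<alpha>(1)[of "r i"] by (simp add: d_def)
        also have "\<dots> \<le> (1 / A) * (\<beta>max * dist (x (r i)) (x (r i - 1)) + dist (x (Suc (r i))) (x (r i)))"
          using d elim A by (intro mult_mono) (auto simp: frac_le)
        finally show ?case .
      qed
      have "(\<lambda>i. (1 / A) * (\<beta>max * dist (x (r i)) (x (r i - 1)) + dist (x (Suc (r i))) (x (r i))))
          \<longlonglongrightarrow> (1 / A) * (\<beta>max * 0 + 0)"
        by (intro tendsto_intros s1 s2)
      then show "(\<lambda>i. (1 / A) * (\<beta>max * dist (x (r i)) (x (r i - 1)) + dist (x (Suc (r i))) (x (r i))))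
          \<longlonglongrightarrow> 0" by simp
    qed
    moreover have "(\<lambda>i. g (x (r i))) \<longlonglongrightarrow> g xbar"
      using continuous_on_tendsto_compose[OF C1 xr] by simp
    ultimately have "(\<lambda>i. v (r i) + g (x (r i)) - g (x (r i))) \<longlonglongrightarrow> 0 - g xbar"
      by (rule tendsto_diff)
    then have v_lim: "(\<lambda>i. v (r i)) \<longlonglongrightarrow> - g xbar" by simp

    \<comment> \<open>A proximal inequality with radius \<open>\<alpha>\<close> implies the one with any smaller radius.\<close>
    have "\<forall>\<^sub>F i in sequentially. \<forall>y\<in>D.
        2 * A * (v (r i) \<bullet> (y - x (Suc (r i)))) \<le> (norm (y - x (Suc (r i))))\<^sup>2"
      using A_le
    proof eventually_elim
      case (elim i)
      show ?case
      proof
        fix y assume "y \<in> D"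
        define q where "q = v (r i) \<bullet> (y - x (Suc (r i)))"
        show "2 * A * q \<le> (norm (y - x (Suc (r i))))\<^sup>2"
        proof (cases "0 \<le> q")
          case True
          then have "2 * A * q \<le> 2 * \<alpha> (r i) * q"
            using elim by (intro mult_right_mono) auto
          then show ?thesis
            using prox[OF \<open>y \<in> D\<close>, of "r i"] by (simp add: q_def)
        next
          case False
          then have "2 * A * q \<le> 0"
            using A by (simp add: mult_nonneg_nonpos)
          then show ?thesis
            by (meson order.trans zero_le_power2)
        qed
      qed
    qed
    then have "- g xbar \<in> prox_normal_cone D xbar"
      by (rule prox_normal_limit[OF D(2) A xD _ v_lim next_lim])
    then show ?thesis
      using v_lim next_lim by blast
  qed

  show ?thesis
  proof (intro conjI allI impI)
    fix xbar r
    assume "strict_mono r" "(x \<circ> r) \<longlonglongrightarrow> xbar"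
    then show "P_stationary D g xbar"
      using key[of r xbar] by (auto simp: P_stationary_def prox_normal_cone_iff)
  next
    fix r :: "nat \<Rightarrow> nat"
    assume r: "strict_mono r" and "convergent (x \<circ> r)"
    then obtain xbar where xbar: "(x \<circ> r) \<longlonglongrightarrow> xbar"
      by (auto simp: convergent_def)
    note lims = key[OF r xbar]
    have "(\<lambda>i. g (x (Suc (r i)))) \<longlonglongrightarrow> g xbar"
      using lims by (intro continuous_on_tendsto_compose[OF C1]) auto
    then have "(\<lambda>i. dist (- g (x (Suc (r i)))) (v (r i))) \<longlonglongrightarrow> dist (- g xbar) (- g xbar)"
      using lims by (intro tendsto_dist tendsto_minus) auto
    then have lim: "(\<lambda>i. dist (- g (x (Suc (r i)))) (v (r i))) \<longlonglongrightarrow> 0"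
      by simp
    show "(\<lambda>i. infdist (- g (x (Suc (r i)))) (prox_normal_cone D (x (Suc (r i))))) \<longlonglongrightarrow> 0"
      by (rule tendsto_sandwich[OF _ _ tendsto_const lim])
        (simp_all add: infdist_nonneg infdist_le v_cone)
  qed
qed

end
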